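(* Let $\mathbb G$ be a finite abelian group of order $n$ and let $\mathcal F=\{f_g\}_{g\in\mathbb G}$ be the $\mathbb G$-harmonic frame for $\mathbb C^m$ generated by $\mathcal S$, where $\mathcal S$ is an $(n,m,\lambda,\mu)$-partial difference set for $\mathbb G$. Then one of the following holds: (1) $\lambda=\mu$ and $\mathcal F$ is an equiangular tight frame; (2) $\lambda\neq\mu$, $0_G\in\mathcal S$, and $\mathcal F$ is a biangular tight frame with frame angles $$\alpha_1,\alpha_2=\frac{\sqrt2}{2m}\sqrt{2(m-\lambda)+(\lambda-\mu)\left(\lambda-\mu\pm\sqrt{(\lambda-\mu)^2+4(m-\lambda)}\right)};$$ (3) $\lambda\neq\mu$, $0_G\notin\mathcal S$, and $\mathcal F$ is a biangular tight frame with frame angles $$\alpha_1,\alpha_2=\frac{\sqrt2}{2m}\sqrt{2(m-\mu)+(\lambda-\mu)\left(\lambda-\mu\pm\sqrt{(\lambda-\mu)^2+4(m-\mu)}\right)}.$$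
   Context: $\mathbb G$ is a finite abelian group of order $n$, written additively with identity $0_G$, with a fixed decomposition $\mathbb G=\mathbb Z_{n_1}\oplus\cdots\oplus\mathbb Z_{n_k}$. For $x,y\in\mathbb G$ put $\rho_x(y)=e^{2\pi i\left(\frac{x(1)y(1)}{n_1}+\cdots+\frac{x(k)y(k)}{n_k}\right)}$. Harmonic frame: for a set $\mathcal S=\{g_1,\dots,g_m\}$ of $m$ distinct elements of $\mathbb G$, the $\mathbb G$-harmonic frame generated by $\mathcal S$ is the family $\{f_x\}_{x\in\mathbb G}\subset\mathbb C^m$ with $f_x=\frac1{\sqrt m}(\rho_{g_j}(x))_{j=1}^m$. A family $\{f_x\}$ in $\mathbb C^m$ is a tight frame if $\sum_x f_xf_x^*=aI_m$ for some $a>0$. The frame angles of a unit-norm frame are the elements of $\{|\langle f_x,f_y\rangle|: x\neq y\}$ (indices distinct); the frame is equiangular (respectively biangular) if this set has exactly one (respectively exactly two) elements. Partial difference set: an $m$-element subset $\mathcal S=\{g_1,\dots,g_m\}\subset\mathbb G$ is an $(n,m,\lambda,\mu)$-partial difference set for $\mathbb G$, where $\lambda,\mu$ are nonnegative integers, if every nonzero element of $\mathcal S$ can be written as $g_a-g_b$ in exactly $\lambda$ ways (number of ordered pairs $(a,b)$), and every element of $\mathbb G\setminus(\mathcal S\cup\{0_G\})$ can be written as $g_a-g_b$ in exactly $\mu$ ways.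
   Formalization: Assumes n ≥ 2 and, when λ ≠ μ, that both S∖{0} and G∖(S∪{0}) are nonempty; otherwise (n = 1, or S = {0}, G or G∖{0} with an unconstrained parameter) the claim fails, as the frame then has at most one angle. *)

theory Defs
  imports "HOL-Analysis.Analysis" "HOL-Algebra.Elementary_Groups" "HOL-Algebra.Product_Groups"
begin

text \<open>HOL-Algebra writes groups multiplicatively: below, \<open>\<one>\<close> is the identity \<open>0\<close> of an additively
  written group and \<open>a \<otimes> inv b\<close> is the difference \<open>a - b\<close>.\<close>

definition cyclic_sum :: "nat \<Rightarrow> (nat \<Rightarrow> nat) \<Rightarrow> (nat \<Rightarrow> int) monoid" where
  "cyclic_sum k N = product_group {1..k} (\<lambda>i. integer_mod_group (N i))"

definition rho :: "nat \<Rightarrow> (nat \<Rightarrow> nat) \<Rightarrow> (nat \<Rightarrow> int) \<Rightarrow> (nat \<Rightarrow> int) \<Rightarrow> complex" where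
  "rho k N x y =
     exp (2 * complex_of_real pi * \<i> * (\<Sum>i=1..k. of_int (x i) * of_int (y i) / of_nat (N i)))"

text \<open>The generating set is enumerated as \<open>g :: 'm \<Rightarrow> _\<close>, so that \<open>m = CARD('m)\<close>.\<close>

definition harmonic_frame ::
  "nat \<Rightarrow> (nat \<Rightarrow> nat) \<Rightarrow> ('m::finite \<Rightarrow> nat \<Rightarrow> int) \<Rightarrow> (nat \<Rightarrow> int) \<Rightarrow> complex ^ 'm" where
  "harmonic_frame k N g x = (\<chi> j. 1 / complex_of_real (sqrt (real CARD('m))) * rho k N (g j) x)"

text \<open>The library's inner product on \<open>complex ^ 'm\<close> is the real one, hence the Hermitian product:\<close>

definition hermitian_inner :: "complex ^ 'm::finite \<Rightarrow> complex ^ 'm \<Rightarrow> complex" where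
  "hermitian_inner u v = (\<Sum>j\<in>UNIV. u $ j * cnj (v $ j))"

text \<open>The matrix \<open>v v\<^sup>*\<close>:\<close>

definition outer_square :: "complex ^ 'm::finite \<Rightarrow> complex ^ 'm ^ 'm" where
  "outer_square v = (\<chi> i j. v $ i * cnj (v $ j))"

definition tight_frame :: "'i set \<Rightarrow> ('i \<Rightarrow> complex ^ 'm::finite) \<Rightarrow> bool" where
  "tight_frame I f \<longleftrightarrow>
     finite I \<and> (\<exists>a::real. a > 0 \<and> (\<Sum>x\<in>I. outer_square (f x)) = mat (complex_of_real a))"

definition unit_norm_family :: "'i set \<Rightarrow> ('i \<Rightarrow> complex ^ 'm::finite) \<Rightarrow> bool" where
  "unit_norm_family I f \<longleftrightarrow> (\<forall>x\<in>I. norm (f x) = 1)"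

text \<open>The indices, not the vectors, are required to be distinct.\<close>

definition frame_angles :: "'i set \<Rightarrow> ('i \<Rightarrow> complex ^ 'm::finite) \<Rightarrow> real set" where
  "frame_angles I f = {cmod (hermitian_inner (f x) (f y)) | x y. x \<in> I \<and> y \<in> I \<and> x \<noteq> y}"

definition equiangular :: "'i set \<Rightarrow> ('i \<Rightarrow> complex ^ 'm::finite) \<Rightarrow> bool" where
  "equiangular I f \<longleftrightarrow> unit_norm_family I f \<and> card (frame_angles I f) = 1"

definition biangular :: "'i set \<Rightarrow> ('i \<Rightarrow> complex ^ 'm::finite) \<Rightarrow> bool" where
  "biangular I f \<longleftrightarrow> unit_norm_family I f \<and> card (frame_angles I f) = 2"

definition difference_count :: "('a, 'b) monoid_scheme \<Rightarrow> 'a set \<Rightarrow> 'a \<Rightarrow> nat" where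
  "difference_count G S h = card {(a, b). a \<in> S \<and> b \<in> S \<and> a \<otimes>\<^bsub>G\<^esub> inv\<^bsub>G\<^esub> b = h}"

definition partial_difference_set ::
  "('a, 'b) monoid_scheme \<Rightarrow> nat \<Rightarrow> nat \<Rightarrow> nat \<Rightarrow> nat \<Rightarrow> 'a set \<Rightarrow> bool" where
  "partial_difference_set G n m lam mu S \<longleftrightarrow>
     comm_group G \<and> finite (carrier G) \<and> order G = n \<and> S \<subseteq> carrier G \<and> card S = m \<and>
     (\<forall>h \<in> S - {\<one>\<^bsub>G\<^esub>}. difference_count G S h = lam) \<and>
     (\<forall>h \<in> carrier G - (S \<union> {\<one>\<^bsub>G\<^esub>}). difference_count G S h = mu)"

end

theory Submission
  imports Defs
begin

text \<open>Write \<open>\<chi>\<close> for a nontrivial character of \<open>G\<close> and \<open>\<chi>(S)\<close> for the sum of its values on \<open>S\<close>.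
  The Hermitian product of two frame vectors \<open>f\<^sub>x\<close> and \<open>f\<^sub>y\<close> is \<open>\<chi>(S) / m\<close> for the character \<open>\<chi>\<close>
  indexed by \<open>x - y\<close>, so the frame angles are the numbers \<open>\<bar>\<chi>(S)\<bar> / m\<close> with \<open>\<chi>\<close> nontrivial;
  tightness is the orthogonality of the characters.

  Expanding \<open>\<bar>\<chi>(S)\<bar>\<^sup>2\<close> over the differences \<open>a - b\<close> of elements of \<open>S\<close>, and using that \<open>\<chi>\<close> sums to
  \<open>0\<close> over \<open>G\<close>, the partial difference set property becomes the single equation
  \<open>\<bar>\<chi>(S)\<bar>\<^sup>2 = c + d \<chi>(S)\<close> (\<open>pds_char_sum_equation\<close>), where \<open>d = \<lambda> - \<mu>\<close>, and \<open>c = m - \<lambda>\<close> or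
  \<open>c = m - \<mu>\<close> according to whether \<open>S\<close> contains the identity.

  If \<open>d = 0\<close>, the modulus does not depend on \<open>\<chi>\<close>, and the frame is equiangular. If \<open>d \<noteq> 0\<close>, the
  equation forces \<open>\<chi>(S)\<close> to be real, hence one of the two roots of \<open>t\<^sup>2 = c + d t\<close>. These have the
  nonzero sum \<open>d\<close>, and they are distinct because \<open>d\<^sup>2 + 4 c > 0\<close>: an element is a difference of
  elements of \<open>S\<close> in at most \<open>m\<close> ways, so \<open>c \<ge> 0\<close>. Hence their absolute values differ. Both roots do
  occur: were \<open>\<chi>(S)\<close> the same for all nontrivial \<open>\<chi>\<close>, Fourier inversion would make the indicator
  function of \<open>S\<close> constant off the identity (\<open>char_sum_nonconstant\<close>), but \<open>S\<close> and its complement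
  both contain elements other than the identity.\<close>

section \<open>Characters of a finite sum of cyclic groups\<close>

text \<open>The pairing \<open>rho\<close> is a symmetric nondegenerate bihomomorphism into the unit circle. It identifies
  \<open>G\<close> with its group of characters, so that elements of \<open>G\<close> index both the frame vectors and the
  characters.\<close>

lemma rho_commute: "rho k N x y = rho k N y x"
  by (simp add: rho_def mult.commute)

lemma cmod_rho [simp]: "cmod (rho k N x y) = 1"
proof -
  have "2 * complex_of_real pi * \<i> * (\<Sum>i=1..k. of_int (x i) * of_int (y i) / of_nat (N i))
      = \<i> * complex_of_real (2 * pi * (\<Sum>i=1..k. of_int (x i) * of_int (y i) / of_nat (N i)))"
    by simp
  then show ?thesis
    unfolding rho_def by (simp only: norm_exp_i_times)
qed

lemma rho_mult_cnj [simp]: "rho k N x y * cnj (rho k N x y) = 1"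
  by (simp add: complex_norm_square [symmetric])

locale cyclic_sum_characters =
  fixes k :: nat and N :: "nat \<Rightarrow> nat" and G :: "(nat \<Rightarrow> int) monoid" (structure)
  assumes N_pos: "\<And>i. i \<in> {1..k} \<Longrightarrow> N i \<ge> 1"
    and G_eq: "G = cyclic_sum k N"
begin

lemma carrier_eq: "carrier G = (\<Pi>\<^sub>E i\<in>{1..k}. {0..<int (N i)})"
  unfolding G_eq cyclic_sum_def carrier_product_group
  using N_pos by (intro PiE_cong) (force simp: carrier_integer_mod_group)

lemma mult_eq: "x \<otimes> y = (\<lambda>i\<in>{1..k}. (x i + y i) mod int (N i))"
  by (simp add: G_eq cyclic_sum_def)

lemma one_eq: "\<one> = (\<lambda>i\<in>{1..k}. 0)"
  by (simp add: G_eq cyclic_sum_def)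

lemma finite_carrier [simp]: "finite (carrier G)"
  by (simp add: carrier_eq finite_PiE)

sublocale comm_group G
proof (rule group.group_comm_groupI)
  show "group G"
    by (simp add: G_eq cyclic_sum_def)
qed (simp add: mult_eq add.commute)

lemma mult_inv_eq_one_iff:
  assumes "x \<in> carrier G" "y \<in> carrier G"
  shows "x \<otimes> inv y = \<one> \<longleftrightarrow> x = y"
  using assms inv_solve_right [of \<one> x y] by auto

lemma order_pos: "order G > 0"
  using order_gt_0_iff_finite by simp

lemma rho_mult_right: "rho k N x (y \<otimes> z) = rho k N x y * rho k N x z"
proof -
  define q where "q = (\<Sum>i=1..k. x i * ((y i + z i) div int (N i)))"
  have term_eq: "of_int (x i) * of_int ((y \<otimes> z) i) / of_nat (N i)
      = of_int (x i) * of_int (y i) / of_nat (N i) + of_int (x i) * of_int (z i) / of_nat (N i)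
        - (of_int (x i * ((y i + z i) div int (N i))) :: complex)" if "i \<in> {1..k}" for i
  proof -
    have "y i + z i = int (N i) * ((y i + z i) div int (N i)) + (y \<otimes> z) i"
      using that by (simp add: mult_eq)
    then have "of_int (y i + z i)
        = (of_nat (N i) * of_int ((y i + z i) div int (N i)) + of_int ((y \<otimes> z) i) :: complex)"
      by (metis of_int_add of_int_mult of_int_of_nat_eq)
    then have coordinate: "of_int ((y \<otimes> z) i)
        = (of_int (y i) + of_int (z i) - of_nat (N i) * of_int ((y i + z i) div int (N i)) :: complex)"
      by (simp add: algebra_simps)
    have "(of_nat (N i) :: complex) \<noteq> 0"
      using N_pos [OF that] by simp
    then show ?thesis
      by (subst coordinate) (simp add: field_simps)
  qed
  have "rho k N x (y \<otimes> z) = rho k N x y * rho k N x z / exp (2 * of_real pi * \<i> * of_int q)"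
    unfolding rho_def q_def
    by (simp add: term_eq sum.distrib sum_subtractf algebra_simps exp_add exp_diff
        del: of_int_mult cong: sum.cong_simp)
  moreover have "exp (2 * of_real pi * \<i> * of_int q) = 1"
    using exp_integer_2pi [of "of_int q"] by (simp add: mult_ac)
  ultimately show ?thesis
    by simp
qed

lemma rho_mult_left: "rho k N (x \<otimes> y) z = rho k N x z * rho k N y z"
  by (metis rho_commute rho_mult_right)

lemma rho_one_right [simp]: "rho k N x \<one> = 1"
  by (simp add: rho_def one_eq)

lemma rho_one_left [simp]: "rho k N \<one> x = 1"
  by (simp add: rho_commute [of k N \<one>])

lemma rho_inv_right:
  assumes "y \<in> carrier G"
  shows "rho k N x (inv y) = cnj (rho k N x y)"
proof -
  have "rho k N x y * rho k N x (inv y) = 1"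
    using assms by (simp flip: rho_mult_right)
  then show ?thesis
    by (metis rho_mult_cnj mult.left_commute mult.right_neutral)
qed

lemma rho_inv_left:
  assumes "x \<in> carrier G"
  shows "rho k N (inv x) y = cnj (rho k N x y)"
  using assms by (simp add: rho_commute [of k N _ y] rho_inv_right)

text \<open>Nondegeneracy: at a nonzero coordinate \<open>i\<close> of \<open>x\<close>, the \<open>i\<close>-th unit vector is detected by \<open>x\<close>.\<close>

lemma rho_nontrivial:
  assumes "x \<in> carrier G" "x \<noteq> \<one>"
  obtains y where "y \<in> carrier G" "rho k N x y \<noteq> 1"
proof -
  obtain i where i: "i \<in> {1..k}" "x i \<noteq> 0"
    using assms by (fastforce simp: carrier_eq one_eq PiE_iff extensional_def)
  then have xi: "0 < x i" "x i < int (N i)"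
    using assms(1) by (force simp: carrier_eq PiE_iff)+
  define y where "y = (\<lambda>j\<in>{1..k}. if j = i then 1 else 0 :: int)"
  have "y \<in> carrier G"
    using xi N_pos by (force simp: carrier_eq y_def PiE_iff)
  moreover have "rho k N x y \<noteq> 1"
  proof
    assume "rho k N x y = 1"
    moreover have "(\<Sum>j=1..k. of_int (x j) * of_int (y j) / of_nat (N j))
        = (\<Sum>j=1..k. if j = i then of_int (x i) / of_nat (N i) else 0 :: complex)"
      by (rule sum.cong) (auto simp: y_def)
    then have "(\<Sum>j=1..k. of_int (x j) * of_int (y j) / of_nat (N j))
        = (complex_of_real (of_int (x i) / of_nat (N i)))"
      using i by simp
    ultimately have "exp (2 * complex_of_real pi * \<i> * complex_of_real (of_int (x i) / of_nat (N i))) = 1"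
      by (simp add: rho_def)
    then obtain l :: int where "2 * pi * (of_int (x i) / of_nat (N i)) = of_int (2 * l) * pi"
      unfolding exp_eq_1 by auto
    then have "(2 * pi) * (of_int (x i) / real (N i)) = (2 * pi) * of_int l"
      by simp
    then have "of_int (x i) / real (N i) = of_int l"
      unfolding mult_cancel_left by simp
    then have "real_of_int (x i) = of_int (l * int (N i))"
      using xi by (simp add: field_simps)
    then have "x i = l * int (N i)"
      by linarith
    then have "int (N i) dvd x i"
      by simp
    with xi show False
      using zdvd_not_zless by blast
  qed
  ultimately show ?thesis
    using that by blast
qed

text \<open>Translating the summation variable by \<open>y\<close> multiplies the sum by \<open>rho k N x y\<close>, which can be chosen
  different from \<open>1\<close> when \<open>x\<close> is not the identity.\<close>

lemma sum_rho:
  assumes "x \<in> carrier G"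
  shows "(\<Sum>y\<in>carrier G. rho k N x y) = (if x = \<one> then of_nat (order G) else 0)"
proof (cases "x = \<one>")
  case True
  then show ?thesis
    by (simp add: order_def)
next
  case False
  then obtain y where y: "y \<in> carrier G" "rho k N x y \<noteq> 1"
    using assms rho_nontrivial by blast
  have "bij_betw ((\<otimes>) y) (carrier G) (carrier G)"
    using y(1) by (simp add: bij_betw_def surj_const_mult inj_on_cmult)
  then have "(\<Sum>z\<in>carrier G. rho k N x z) = (\<Sum>z\<in>carrier G. rho k N x (y \<otimes> z))"
    by (rule sum.reindex_bij_betw [symmetric])
  also have "\<dots> = rho k N x y * (\<Sum>z\<in>carrier G. rho k N x z)"
    by (simp add: rho_mult_right sum_distrib_left)
  finally show ?thesis
    using y(2) False by simp
qed

lemma rho_orthogonality: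
  assumes "x \<in> carrier G" "y \<in> carrier G"
  shows "(\<Sum>z\<in>carrier G. rho k N x z * cnj (rho k N y z)) = (if x = y then of_nat (order G) else 0)"
proof -
  have "(\<Sum>z\<in>carrier G. rho k N x z * cnj (rho k N y z)) = (\<Sum>z\<in>carrier G. rho k N (x \<otimes> inv y) z)"
    using assms by (simp add: rho_mult_left rho_inv_left)
  then show ?thesis
    using assms by (simp add: sum_rho mult_inv_eq_one_iff)
qed

section \<open>Character sums over a subset\<close>

definition char_sum :: "(nat \<Rightarrow> int) set \<Rightarrow> (nat \<Rightarrow> int) \<Rightarrow> complex" where
  "char_sum S x = (\<Sum>s\<in>S. rho k N s x)"

lemma char_sum_one [simp]: "char_sum S \<one> = of_nat (card S)"
  by (simp add: char_sum_def)

lemma cmod_char_sum_square: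
  assumes S: "S \<subseteq> carrier G" and x: "x \<in> carrier G"
  shows "complex_of_real ((cmod (char_sum S x))\<^sup>2)
    = (\<Sum>h\<in>carrier G. of_nat (difference_count G S h) * rho k N h x)"
proof -
  have fin: "finite S"
    by (rule finite_subset [OF S finite_carrier])
  have "complex_of_real ((cmod (char_sum S x))\<^sup>2)
      = (\<Sum>(a, b)\<in>S \<times> S. rho k N a x * cnj (rho k N b x))"
    by (simp only: complex_norm_square) (simp add: char_sum_def sum_product sum.cartesian_product)
  also have "\<dots> = (\<Sum>p\<in>S \<times> S. rho k N (fst p \<otimes> inv (snd p)) x)"
    using S by (intro sum.cong) (auto simp: rho_mult_left rho_inv_left)
  also have "\<dots> = (\<Sum>h\<in>carrier G. \<Sum>p\<in>{p \<in> S \<times> S. fst p \<otimes> inv (snd p) = h}.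
      rho k N (fst p \<otimes> inv (snd p)) x)"
    using S fin by (intro sum.group [symmetric]) (auto simp: subset_iff)
  also have "\<dots> = (\<Sum>h\<in>carrier G. of_nat (difference_count G S h) * rho k N h x)"
  proof (rule sum.cong [OF refl])
    fix h
    have "(\<Sum>p\<in>{p \<in> S \<times> S. fst p \<otimes> inv (snd p) = h}. rho k N (fst p \<otimes> inv (snd p)) x)
        = (\<Sum>p\<in>{p \<in> S \<times> S. fst p \<otimes> inv (snd p) = h}. rho k N h x)"
      by (rule sum.cong) auto
    moreover have "{p \<in> S \<times> S. fst p \<otimes> inv (snd p) = h} = {(a, b). a \<in> S \<and> b \<in> S \<and> a \<otimes> inv b = h}"
      by auto
    ultimately show "(\<Sum>p\<in>{p \<in> S \<times> S. fst p \<otimes> inv (snd p) = h}. rho k N (fst p \<otimes> inv (snd p)) x)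
        = of_nat (difference_count G S h) * rho k N h x"
      by (simp add: difference_count_def)
  qed
  finally show ?thesis .
qed

text \<open>This is Fourier inversion for the indicator function of \<open>S\<close>: if all its nontrivial Fourier
  coefficients equal \<open>t\<close>, then it differs from \<open>t\<close> times the indicator function of the identity
  by a constant.\<close>

lemma char_sum_nonconstant:
  assumes S: "S \<subseteq> carrier G"
    and u: "u \<in> S" "u \<noteq> \<one>"
    and v: "v \<in> carrier G" "v \<notin> S" "v \<noteq> \<one>"
  obtains x y where "x \<in> carrier G - {\<one>}" "y \<in> carrier G - {\<one>}" "char_sum S x \<noteq> char_sum S y"
proof -
  have fin: "finite S"
    by (rule finite_subset [OF S finite_carrier])
  have inversion: "(\<Sum>x\<in>carrier G. char_sum S x * cnj (rho k N h x))
      = (if h \<in> S then of_nat (order G) else 0)" if h: "h \<in> carrier G" for h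
  proof -
    have "(\<Sum>x\<in>carrier G. char_sum S x * cnj (rho k N h x))
        = (\<Sum>s\<in>S. \<Sum>x\<in>carrier G. rho k N s x * cnj (rho k N h x))"
      by (simp add: char_sum_def sum_distrib_right) (rule sum.swap)
    also have "\<dots> = (\<Sum>s\<in>S. if s = h then of_nat (order G) else 0)"
      using S h by (intro sum.cong refl rho_orthogonality) auto
    finally show ?thesis
      using fin by simp
  qed
  have False if const: "\<And>x. x \<in> carrier G - {\<one>} \<Longrightarrow> char_sum S x = t" for t
  proof -
    have off_identity: "(\<Sum>x\<in>carrier G. char_sum S x * cnj (rho k N h x)) = of_nat (card S) - t"
      if h: "h \<in> carrier G" "h \<noteq> \<one>" for h
    proof -
      have "(\<Sum>x\<in>carrier G. cnj (rho k N h x)) = 0"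
        using h sum_rho [of h] by (simp flip: cnj_sum)
      then have "(\<Sum>x\<in>carrier G - {\<one>}. cnj (rho k N h x)) = - 1"
        by (simp add: sum_diff1)
      moreover have "(\<Sum>x\<in>carrier G. char_sum S x * cnj (rho k N h x))
          = of_nat (card S) + (\<Sum>x\<in>carrier G - {\<one>}. char_sum S x * cnj (rho k N h x))"
        by (simp add: sum.remove [of _ \<one>])
      moreover have "(\<Sum>x\<in>carrier G - {\<one>}. char_sum S x * cnj (rho k N h x))
          = t * (\<Sum>x\<in>carrier G - {\<one>}. cnj (rho k N h x))"
        by (simp add: const sum_distrib_left)
      ultimately show ?thesis
        by simp
    qed
    have "of_nat (order G) = (0 :: complex)"
      using inversion [of u] inversion [of v] off_identity [of u] off_identity [of v] u v subsetD [OF S u(1)]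
      by simp
    then show False
      using order_pos by simp
  qed
  then show ?thesis
    using that by metis
qed

section \<open>Partial difference sets\<close>

lemma difference_count_one:
  assumes "S \<subseteq> carrier G"
  shows "difference_count G S \<one> = card S"
proof -
  have "{(a, b). a \<in> S \<and> b \<in> S \<and> a \<otimes> inv b = \<one>} = (\<lambda>a. (a, a)) ` S"
    using assms by (auto simp: subset_iff mult_inv_eq_one_iff)
  then show ?thesis
    by (simp add: difference_count_def card_image inj_on_def)
qed

text \<open>In a representation of \<open>h\<close> as a difference, the second element determines the first.\<close>

lemma difference_count_le:
  assumes "S \<subseteq> carrier G"
  shows "difference_count G S h \<le> card S"
proof -
  let ?P = "{(a, b). a \<in> S \<and> b \<in> S \<and> a \<otimes> inv b = h}"
  have "inj_on snd ?P"
    using assms by (auto simp: inj_on_def subset_iff)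
  moreover have "snd ` ?P \<subseteq> S" "finite S"
    using finite_subset [OF assms finite_carrier] by auto
  ultimately show ?thesis
    unfolding difference_count_def using card_inj_on_le by blast
qed

lemma pds_char_sum_equation:
  fixes lam mu :: nat
  assumes pds: "partial_difference_set G n m lam mu S"
    and x: "x \<in> carrier G" "x \<noteq> \<one>"
  shows "complex_of_real ((cmod (char_sum S x))\<^sup>2)
    = of_real (real m - (if \<one> \<in> S then real lam else real mu))
      + of_real (real lam - real mu) * char_sum S x"
proof -
  let ?\<rho> = "\<lambda>h. rho k N h x" and ?c = "\<lambda>h. of_nat (difference_count G S h) :: complex"
  let ?A = "S - {\<one>}" and ?B = "carrier G - (S \<union> {\<one>})"
  have S: "S \<subseteq> carrier G" "card S = m"
    and lam: "\<And>h. h \<in> ?A \<Longrightarrow> difference_count G S h = lam"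
    and mu: "\<And>h. h \<in> ?B \<Longrightarrow> difference_count G S h = mu"
    using pds by (auto simp: partial_difference_set_def)
  have fin: "finite S"
    by (rule finite_subset [OF S(1) finite_carrier])
  have split: "(\<Sum>h\<in>carrier G. f h) = f \<one> + (\<Sum>h\<in>?A. f h) + (\<Sum>h\<in>?B. f h)"
    for f :: "_ \<Rightarrow> complex"
  proof -
    have "carrier G - {\<one>} = ?A \<union> ?B"
      using S by auto
    moreover have "(\<Sum>h\<in>?A \<union> ?B. f h) = (\<Sum>h\<in>?A. f h) + (\<Sum>h\<in>?B. f h)"
      using fin by (intro sum.union_disjoint) auto
    ultimately show ?thesis
      by (simp add: sum.remove [of _ \<one>])
  qed
  have A: "(\<Sum>h\<in>?A. ?\<rho> h) = char_sum S x - (if \<one> \<in> S then 1 else 0)"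
    using fin by (simp add: char_sum_def sum_diff1)
  have "(\<Sum>h\<in>carrier G. ?\<rho> h) = 0"
    using x sum_rho [of x] by (simp add: rho_commute [of k N _ x])
  then have B: "(\<Sum>h\<in>?B. ?\<rho> h) = - 1 - (\<Sum>h\<in>?A. ?\<rho> h)"
    by (simp add: split [of ?\<rho>] algebra_simps add_eq_0_iff)
  have "complex_of_real ((cmod (char_sum S x))\<^sup>2) = (\<Sum>h\<in>carrier G. ?c h * ?\<rho> h)"
    using S(1) x(1) by (rule cmod_char_sum_square)
  also have "\<dots> = of_nat m + of_nat lam * (\<Sum>h\<in>?A. ?\<rho> h) + of_nat mu * (\<Sum>h\<in>?B. ?\<rho> h)"
    using S by (simp add: split difference_count_one lam mu sum_distrib_left)
  finally show ?thesis
    unfolding B A by (cases "\<one> \<in> S") (simp_all add: algebra_simps)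
qed

section \<open>The harmonic frame of a subset\<close>

lemma hermitian_inner_harmonic_frame:
  fixes g :: "'m::finite \<Rightarrow> nat \<Rightarrow> int"
  assumes g: "bij_betw g UNIV S" and y: "y \<in> carrier G"
  shows "hermitian_inner (harmonic_frame k N g x) (harmonic_frame k N g y)
    = char_sum S (x \<otimes> inv y) / of_nat CARD('m)"
proof -
  have sq: "complex_of_real (sqrt (real CARD('m))) * complex_of_real (sqrt (real CARD('m)))
      = of_nat CARD('m)"
    by (simp flip: of_real_mult)
  have "hermitian_inner (harmonic_frame k N g x) (harmonic_frame k N g y)
      = (\<Sum>j\<in>UNIV. rho k N (g j) (x \<otimes> inv y) / of_nat CARD('m))"
    using y sq by (simp add: hermitian_inner_def harmonic_frame_def rho_mult_right rho_inv_right)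
  also have "\<dots> = char_sum S (x \<otimes> inv y) / of_nat CARD('m)"
    using sum.reindex_bij_betw [OF g, of "\<lambda>s. rho k N s (x \<otimes> inv y)"]
    by (simp add: char_sum_def flip: sum_divide_distrib)
  finally show ?thesis .
qed

lemma frame_angles_harmonic_frame:
  fixes g :: "'m::finite \<Rightarrow> nat \<Rightarrow> int"
  assumes g: "bij_betw g UNIV S"
  shows "frame_angles (carrier G) (harmonic_frame k N g)
    = (\<lambda>z. cmod (char_sum S z) / real CARD('m)) ` (carrier G - {\<one>})"
proof -
  have "frame_angles (carrier G) (harmonic_frame k N g)
      = {cmod (char_sum S (x \<otimes> inv y)) / real CARD('m) | x y.
          x \<in> carrier G \<and> y \<in> carrier G \<and> x \<noteq> y}"
    unfolding frame_angles_def
    by (intro Collect_cong ex_cong1) (auto simp: hermitian_inner_harmonic_frame [OF g] norm_divide)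
  also have "\<dots> = (\<lambda>z. cmod (char_sum S z) / real CARD('m)) ` (carrier G - {\<one>})"
  proof (intro equalityI subsetI)
    fix r
    assume "r \<in> {cmod (char_sum S (x \<otimes> inv y)) / real CARD('m) | x y.
      x \<in> carrier G \<and> y \<in> carrier G \<and> x \<noteq> y}"
    then obtain x y where "x \<in> carrier G" "y \<in> carrier G" "x \<noteq> y"
      and r: "r = cmod (char_sum S (x \<otimes> inv y)) / real CARD('m)"
      by auto
    then have "x \<otimes> inv y \<in> carrier G - {\<one>}"
      by (simp add: mult_inv_eq_one_iff)
    with r show "r \<in> (\<lambda>z. cmod (char_sum S z) / real CARD('m)) ` (carrier G - {\<one>})"
      by blast
  next
    fix r
    assume "r \<in> (\<lambda>z. cmod (char_sum S z) / real CARD('m)) ` (carrier G - {\<one>})"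
    then obtain z where "z \<in> carrier G" "z \<noteq> \<one>" "r = cmod (char_sum S (z \<otimes> inv \<one>)) / real CARD('m)"
      by auto
    then show "r \<in> {cmod (char_sum S (x \<otimes> inv y)) / real CARD('m) | x y.
      x \<in> carrier G \<and> y \<in> carrier G \<and> x \<noteq> y}"
      using one_closed by blast
  qed
  finally show ?thesis .
qed

lemma unit_norm_harmonic_frame: "unit_norm_family I (harmonic_frame k N g)"
  by (simp add: unit_norm_family_def norm_vec_def L2_set_def harmonic_frame_def norm_mult
      norm_divide power_divide)

lemma tight_harmonic_frame:
  fixes g :: "'m::finite \<Rightarrow> nat \<Rightarrow> int"
  assumes g: "inj g" "range g \<subseteq> carrier G"
  shows "tight_frame (carrier G) (harmonic_frame k N g)"
proof -
  let ?a = "real (order G) / real CARD('m)"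
  have sq: "complex_of_real (sqrt (real CARD('m))) * complex_of_real (sqrt (real CARD('m)))
      = of_nat CARD('m)"
    by (simp flip: of_real_mult)
  have "(\<Sum>x\<in>carrier G. outer_square (harmonic_frame k N g x)) $ i $ j
      = mat (complex_of_real ?a) $ i $ j" for i j
  proof -
    have "(\<Sum>x\<in>carrier G. outer_square (harmonic_frame k N g x)) $ i $ j
        = (\<Sum>x\<in>carrier G. rho k N (g i) x * cnj (rho k N (g j) x)) / of_nat CARD('m)"
      using sq by (simp add: outer_square_def harmonic_frame_def sum_divide_distrib)
    also have "\<dots> = mat (complex_of_real ?a) $ i $ j"
      using g by (subst rho_orthogonality) (auto simp: mat_def inj_eq)
    finally show ?thesis .
  qed
  then have "(\<Sum>x\<in>carrier G. outer_square (harmonic_frame k N g x)) = mat (complex_of_real ?a)"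
    by (simp add: vec_eq_iff)
  moreover have "?a > 0"
    using order_pos by simp
  ultimately show ?thesis
    unfolding tight_frame_def using finite_carrier by blast
qed

end

section \<open>The two angles\<close>

text \<open>The radicand is \<open>2 (c + d t)\<close>, that is \<open>2 t\<^sup>2\<close>, for the root \<open>t = (d + r) / 2\<close> of
  \<open>t\<^sup>2 = c + d t\<close>; the sign of \<open>r\<close> selects the root.\<close>

lemma abs_root_eq:
  fixes c d r m :: real
  assumes "r\<^sup>2 = d\<^sup>2 + 4 * c"
  shows "sqrt 2 / (2 * m) * sqrt (2 * c + d * (d + r)) = \<bar>(d + r) / 2\<bar> / m"
proof -
  have "2 * c + d * (d + r) = (d + r)\<^sup>2 / 2"
    using assms by (simp add: power2_eq_square field_simps)
  then have "sqrt (2 * c + d * (d + r)) = \<bar>d + r\<bar> / sqrt 2"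
    by (simp only: real_sqrt_divide real_sqrt_abs)
  then show ?thesis
    by simp
qed

text \<open>Since \<open>d \<noteq> 0\<close>, the equation makes \<open>char_sum S x\<close> real; both of its possible values occur by
  \<open>char_sum_nonconstant\<close>, and they have different absolute values since neither their difference
  nor their sum \<open>d\<close> vanishes.\<close>

lemma (in cyclic_sum_characters) two_char_sum_moduli:
  fixes c d m :: real
  assumes equation: "\<And>x. x \<in> carrier G - {\<one>} \<Longrightarrow>
      complex_of_real ((cmod (char_sum S x))\<^sup>2) = of_real c + of_real d * char_sum S x"
    and d: "d \<noteq> 0" and c: "c \<ge> 0" and m: "m > 0"
    and S: "S \<subseteq> carrier G" "S - {\<one>} \<noteq> {}" "carrier G - (S \<union> {\<one>}) \<noteq> {}"
  defines "\<alpha> \<equiv> sqrt 2 / (2 * m) * sqrt (2 * c + d * (d + sqrt (d\<^sup>2 + 4 * c)))"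
    and "\<beta> \<equiv> sqrt 2 / (2 * m) * sqrt (2 * c + d * (d - sqrt (d\<^sup>2 + 4 * c)))"
  shows "(\<lambda>z. cmod (char_sum S z) / m) ` (carrier G - {\<one>}) = {\<alpha>, \<beta>}" and "\<alpha> \<noteq> \<beta>"
proof -
  define r where "r = sqrt (d\<^sup>2 + 4 * c)"
  have pos: "d\<^sup>2 + 4 * c > 0"
    using c d by (simp add: add_pos_nonneg)
  then have r: "r\<^sup>2 = d\<^sup>2 + 4 * c" "r > 0"
    by (simp_all add: r_def)
  have \<alpha>: "\<alpha> = \<bar>(d + r) / 2\<bar> / m"
    unfolding \<alpha>_def r_def [symmetric] by (rule abs_root_eq) (rule r)
  have \<beta>: "\<beta> = \<bar>(d - r) / 2\<bar> / m"
    using abs_root_eq [of "- r" d c m] r by (simp add: \<beta>_def r_def [symmetric])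
  show "\<alpha> \<noteq> \<beta>"
    using d r(2) m by (auto simp: \<alpha> \<beta> abs_eq_iff)
  have root: "char_sum S x \<in> {of_real ((d + r) / 2), of_real ((d - r) / 2)}"
    if x: "x \<in> carrier G - {\<one>}" for x
  proof -
    define t where "t = ((cmod (char_sum S x))\<^sup>2 - c) / d"
    have t: "char_sum S x = of_real t"
      using equation [OF x] d by (simp add: t_def field_simps)
    have "complex_of_real (t\<^sup>2) = of_real (c + d * t)"
      using equation [OF x] by (simp add: t)
    then have "t\<^sup>2 = c + d * t"
      by (simp only: of_real_eq_iff)
    then have "(2 * t - d)\<^sup>2 = r\<^sup>2"
      unfolding r by (simp add: power2_eq_square algebra_simps)
    then have "2 * t - d = r \<or> 2 * t - d = - r"
      by (simp add: power2_eq_iff)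
    then have "t = (d + r) / 2 \<or> t = (d - r) / 2"
      by auto
    then show ?thesis
      unfolding t by (elim disjE) (simp_all only: insert_iff simp_thms)
  qed
  obtain x y where xy: "x \<in> carrier G - {\<one>}" "y \<in> carrier G - {\<one>}" "char_sum S x \<noteq> char_sum S y"
    using char_sum_nonconstant S by blast
  have "char_sum S ` (carrier G - {\<one>}) = {of_real ((d + r) / 2), of_real ((d - r) / 2)}"
  proof
    show "char_sum S ` (carrier G - {\<one>}) \<subseteq> {of_real ((d + r) / 2), of_real ((d - r) / 2)}"
      using root by blast
    have "{p, q} = {u, v}" if "u \<in> {p, q}" "v \<in> {p, q}" "u \<noteq> v" for p q u v :: complex
      using that by auto
    then have "{of_real ((d + r) / 2), of_real ((d - r) / 2)} = {char_sum S x, char_sum S y}"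
      using root [OF xy(1)] root [OF xy(2)] xy(3) .
    then show "{of_real ((d + r) / 2), of_real ((d - r) / 2)} \<subseteq> char_sum S ` (carrier G - {\<one>})"
      using xy(1,2) by simp
  qed
  then have "(\<lambda>t. cmod t / m) ` char_sum S ` (carrier G - {\<one>}) = {\<alpha>, \<beta>}"
    by (simp only: image_insert image_empty norm_of_real \<alpha> \<beta>)
  then show "(\<lambda>z. cmod (char_sum S z) / m) ` (carrier G - {\<one>}) = {\<alpha>, \<beta>}"
    by (simp only: image_image)
qed

theorem theorem4p24:
  fixes k n m lam mu :: nat
    and N :: "nat \<Rightarrow> nat"
    and G :: "(nat \<Rightarrow> int) monoid"
    and S :: "(nat \<Rightarrow> int) set"
    and g :: "'m::finite \<Rightarrow> nat \<Rightarrow> int"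
    and F :: "(nat \<Rightarrow> int) \<Rightarrow> complex ^ 'm"
  assumes N_pos: "\<forall>i\<in>{1..k}. N i \<ge> 1"
    and G: "G = cyclic_sum k N"
    and pds: "partial_difference_set G n m lam mu S"
    and g: "bij_betw g UNIV S"
    and F: "F = harmonic_frame k N g"
    and n: "n \<ge> 2"
    and parameters_determined:
      "lam \<noteq> mu \<Longrightarrow> S - {\<one>\<^bsub>G\<^esub>} \<noteq> {} \<and> carrier G - (S \<union> {\<one>\<^bsub>G\<^esub>}) \<noteq> {}"
  shows
    "(lam = mu \<and> equiangular (carrier G) F \<and> tight_frame (carrier G) F)
     \<or>
     (lam \<noteq> mu \<and> \<one>\<^bsub>G\<^esub> \<in> S \<and> biangular (carrier G) F \<and> tight_frame (carrier G) F \<and>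
      frame_angles (carrier G) F =
       {sqrt 2 / (2 * real m) *
          sqrt (2 * (real m - real lam) + (real lam - real mu) *
            (real lam - real mu + sqrt ((real lam - real mu)^2 + 4 * (real m - real lam)))),
        sqrt 2 / (2 * real m) *
          sqrt (2 * (real m - real lam) + (real lam - real mu) *
            (real lam - real mu - sqrt ((real lam - real mu)^2 + 4 * (real m - real lam))))})
     \<or>
     (lam \<noteq> mu \<and> \<one>\<^bsub>G\<^esub> \<notin> S \<and> biangular (carrier G) F \<and> tight_frame (carrier G) F \<and>
      frame_angles (carrier G) F =
       {sqrt 2 / (2 * real m) *
          sqrt (2 * (real m - real mu) + (real lam - real mu) *
            (real lam - real mu + sqrt ((real lam - real mu)^2 + 4 * (real m - real mu)))),
        sqrt 2 / (2 * real m) *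
          sqrt (2 * (real m - real mu) + (real lam - real mu) *
            (real lam - real mu - sqrt ((real lam - real mu)^2 + 4 * (real m - real mu))))})"
proof -
  interpret cyclic_sum_characters k N G
    using N_pos G by unfold_locales auto
  have S: "S \<subseteq> carrier G" "card S = m" and order_n: "order G = n"
    and lam: "\<And>h. h \<in> S - {\<one>\<^bsub>G\<^esub>} \<Longrightarrow> difference_count G S h = lam"
    and mu: "\<And>h. h \<in> carrier G - (S \<union> {\<one>\<^bsub>G\<^esub>}) \<Longrightarrow> difference_count G S h = mu"
    using pds by (auto simp: partial_difference_set_def)
  have m: "m = CARD('m)"
    using g S(2) by (simp add: bij_betw_same_card)
  then have m_pos: "real m > 0"
    by simp
  have tight: "tight_frame (carrier G) F"
    unfolding F using g S(1) by (intro tight_harmonic_frame) (auto simp: bij_betw_def)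
  have unit: "unit_norm_family (carrier G) F"
    unfolding F by (rule unit_norm_harmonic_frame)
  have angles: "frame_angles (carrier G) F
      = (\<lambda>z. cmod (char_sum S z) / real m) ` (carrier G - {\<one>\<^bsub>G\<^esub>})"
    unfolding F m by (rule frame_angles_harmonic_frame) (rule g)
  define \<nu> where "\<nu> = (if \<one>\<^bsub>G\<^esub> \<in> S then lam else mu)"
  have equation: "complex_of_real ((cmod (char_sum S x))\<^sup>2)
      = of_real (real m - real \<nu>) + of_real (real lam - real mu) * char_sum S x"
    if "x \<in> carrier G - {\<one>\<^bsub>G\<^esub>}" for x
    using pds_char_sum_equation [OF pds, of x] that by (simp add: \<nu>_def)
  show ?thesis
  proof (cases "lam = mu")
    case True
    have "cmod (char_sum S x) = sqrt (real m - real \<nu>)" if "x \<in> carrier G - {\<one>\<^bsub>G\<^esub>}" for x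
    proof -
      have "complex_of_real ((cmod (char_sum S x))\<^sup>2) = of_real (real m - real \<nu>)"
        using equation [OF that] True by simp
      then have "(cmod (char_sum S x))\<^sup>2 = real m - real \<nu>"
        by (simp only: of_real_eq_iff)
      then show ?thesis
        by (metis norm_ge_zero real_sqrt_unique)
    qed
    moreover have "carrier G - {\<one>\<^bsub>G\<^esub>} \<noteq> {}"
    proof
      assume "carrier G - {\<one>\<^bsub>G\<^esub>} = {}"
      then have "card (carrier G) \<le> card {\<one>\<^bsub>G\<^esub>}"
        by (intro card_mono) auto
      then show False
        using n order_n by (simp add: order_def)
    qed
    ultimately have "frame_angles (carrier G) F = {sqrt (real m - real \<nu>) / real m}"
      unfolding angles by (auto simp: image_iff)
    then show ?thesis
      using True unit tight by (simp add: equiangular_def)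
  next
    case False
    then have ne: "S - {\<one>\<^bsub>G\<^esub>} \<noteq> {}" "carrier G - (S \<union> {\<one>\<^bsub>G\<^esub>}) \<noteq> {}"
      using parameters_determined by auto
    \<comment> \<open>As both sets are nonempty, \<open>lam\<close> and \<open>mu\<close> are actual difference counts.\<close>
    have "lam \<le> m" "mu \<le> m"
      using ne lam mu difference_count_le [OF S(1)] S(2) by fastforce+
    then have c: "real m - real \<nu> \<ge> 0"
      by (simp add: \<nu>_def)
    have d: "real lam - real mu \<noteq> 0"
      using False by simp
    note two = two_char_sum_moduli [OF equation d c m_pos S(1) ne, folded angles]
    have "biangular (carrier G) F"
      using unit two by (simp add: biangular_def)
    then show ?thesis
      using False tight two(1) by (simp add: \<nu>_def)
  qed
qed

end
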